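(* Let $f\colon\mathbb{R}^d\to\mathbb{R}$ be $C^2$. Consider gradient descent $x_{k+1}=g_k(x_k)$ with $g_k(x)=x-\alpha_k\nabla f(x)$, $k\ge0$, with given $\alpha_0>0$ and one of the following step-size schedules for $k\ge1$: (1) Constant: $\alpha_k=\alpha_0$. (2) Polynomial decay: $\alpha_k=\frac{\alpha_0}{(k+1)^\gamma}$ for some $\gamma\in(0,1]$. (3) Cosine decay: $\alpha_k=\frac{\alpha_0}{(k+1)^\gamma}\Big(1+\cos\!\big(\frac{\pi(k+\frac12)}{2T+1}\big)\Big)$ for some $\gamma\in(0,1]$ and integer $T\ge0$. Then, for each of these schedules, for each fixed choice of the auxiliary parameters ($\gamma$, $T$) and for (Lebesgue) almost all $\alpha_0>0$, gradient descent avoids the strict saddle points of $f$.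
   Context: A strict saddle point of $f$ is a point $x^\ast$ with $\nabla f(x^\ast)=0$ such that the Hessian $\nabla^2 f(x^\ast)$ has at least one negative eigenvalue. The system $(g_k)_{k\ge0}$ avoids a set $S\subseteq\mathbb{R}^d$ if the set of initial points $x_0\in\mathbb{R}^d$ for which the trajectory $x_{k+1}=g_k(x_k)$, $k\ge0$, converges to some point of $S$ has Lebesgue measure zero. *)

theory Defs
  imports "HOL-Analysis.Analysis"
begin

definition gradient :: "('a::real_inner \<Rightarrow> real) \<Rightarrow> 'a \<Rightarrow> 'a" where
  "gradient f x = (THE D. GDERIV f x :> D)"

definition hessian :: "(real ^ 'n \<Rightarrow> real) \<Rightarrow> real ^ 'n \<Rightarrow> real ^ 'n ^ 'n" where
  "hessian f x = jacobian (gradient f) (at x)"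

definition C2 :: "(real ^ 'n \<Rightarrow> real) \<Rightarrow> bool" where
  "C2 f \<longleftrightarrow> (\<forall>x. f differentiable (at x)) \<and>
     (\<forall>x. gradient f differentiable (at x)) \<and>
     continuous_on UNIV (hessian f)"

(* Only real eigenvalues are needed: the Hessian of a C^2 function is symmetric. *)
definition is_eigenvalue :: "real ^ 'n ^ 'n \<Rightarrow> real \<Rightarrow> bool" where
  "is_eigenvalue A c \<longleftrightarrow> (\<exists>v. v \<noteq> 0 \<and> A *v v = c *\<^sub>R v)"

definition strict_saddle_points :: "(real ^ 'n \<Rightarrow> real) \<Rightarrow> (real ^ 'n) set" where
  "strict_saddle_points f =
     {x. gradient f x = 0 \<and> (\<exists>c<0. is_eigenvalue (hessian f x) c)}"

primrec trajectory :: "(nat \<Rightarrow> 'a \<Rightarrow> 'a) \<Rightarrow> 'a \<Rightarrow> nat \<Rightarrow> 'a" where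
  "trajectory g x0 0 = x0"
| "trajectory g x0 (Suc k) = g k (trajectory g x0 k)"

definition avoids :: "(nat \<Rightarrow> 'a::euclidean_space \<Rightarrow> 'a) \<Rightarrow> 'a set \<Rightarrow> bool" where
  "avoids g S \<longleftrightarrow> {x0. \<exists>x\<in>S. trajectory g x0 \<longlonglongrightarrow> x} \<in> null_sets lebesgue"

definition gradient_descent ::
    "('a::real_inner \<Rightarrow> real) \<Rightarrow> (nat \<Rightarrow> real) \<Rightarrow> nat \<Rightarrow> 'a \<Rightarrow> 'a" where
  "gradient_descent f \<alpha> k x = x - \<alpha> k *\<^sub>R gradient f x"

definition constant_step :: "real \<Rightarrow> nat \<Rightarrow> real" where
  "constant_step \<alpha>0 k = \<alpha>0"

definition polynomial_step :: "real \<Rightarrow> real \<Rightarrow> nat \<Rightarrow> real" where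
  "polynomial_step \<gamma> \<alpha>0 k = \<alpha>0 / (real k + 1) powr \<gamma>"

(* The cosine formula is prescribed for k >= 1 only: the step at k = 0 is \<alpha>0 itself,
   which the formula would not give unless T = 0. *)
definition cosine_step :: "real \<Rightarrow> nat \<Rightarrow> real \<Rightarrow> nat \<Rightarrow> real" where
  "cosine_step \<gamma> T \<alpha>0 k =
     (if k = 0 then \<alpha>0
      else \<alpha>0 / (real k + 1) powr \<gamma> * (1 + cos (pi * (real k + 1/2) / (2 * real T + 1))))"

lemma gradient_eqI:
  assumes "GDERIV f x :> D"
  shows "gradient f x = D"
  unfolding gradient_def
proof (rule the_equality)
  fix D' assume "GDERIV f x :> D'"
  then have "(\<lambda>h. inner h D') = (\<lambda>h. inner h D)"
    using assms has_derivative_unique unfolding gderiv_def by blast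
  then have "inner h (D' - D) = 0" for h
    by (metis inner_diff_right right_minus_eq)
  then have "inner (D' - D) (D' - D) = 0" .
  then show "D' = D" by simp
qed (rule assms)

lemma GDERIV_gradient:
  fixes f :: "'a::euclidean_space \<Rightarrow> real"
  assumes "f differentiable (at x)"
  shows "GDERIV f x :> gradient f x"
proof -
  from assms obtain f' where f': "(f has_derivative f') (at x)"
    unfolding differentiable_def by blast
  interpret linear f' using f' by (rule has_derivative_linear)
  define D where "D = (\<Sum>b\<in>Basis. f' b *\<^sub>R b)"
  have "f' h = inner h D" for h
  proof -
    have "f' h = f' (\<Sum>b\<in>Basis. inner h b *\<^sub>R b)"
      by (simp add: euclidean_representation)
    also have "\<dots> = inner h D"
      by (simp add: D_def sum scale inner_sum_right mult.commute)
    finally show ?thesis .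
  qed
  then have "GDERIV f x :> D"
    using f' unfolding gderiv_def by presburger
  then show ?thesis
    using gradient_eqI by metis
qed

end

theory Submission
  imports Defs
begin

text \<open>Initial points from which gradient descent converges to a strict saddle point form a null set for two
  reasons, one local and one global.

  The local reason is the instability of a strict saddle \<open>s\<close>. The Hessian at \<open>s\<close> is symmetric, so in an
  orthonormal eigenbasis the linearized step multiplies the coordinate for the eigenvalue \<open>c\<close> by
  \<open>1 - \<alpha> k * c\<close>. Eventually each of these factors has modulus either at least
  \<open>1 + \<alpha> k * m\<close> for a fixed \<open>m > 0\<close>, or at most 1
  (\<open>rate_dichotomy\<close>), and a negative eigenvalue gives the first case. In a small ball
  around \<open>s\<close> the gradient differs from its linearization by a map with a small Lipschitz constant, so the
  difference of two trajectories that starts in the cone where the expanding component dominates stays in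
  this cone and grows (\<open>cone_step\<close>). Since the step sizes have infinite sum, it
  grows without bound, which is impossible within the ball. Hence the points whose trajectories stay
  in the ball forever form a Lipschitz graph over the nonexpanding directions, a null set
  (\<open>negligible_trapped_points\<close>): they lie on a Lipschitz version of the centre-stable manifold.

  The global reason is that a gradient step pulls null sets back to null sets, provided that its
  Jacobian \<open>I - \<alpha> k * H x\<close> is invertible for almost all \<open>x\<close>. With \<open>\<alpha> k = \<alpha>0 * c k\<close> and
  \<open>x\<close> fixed, only finitely many \<open>\<alpha>0\<close> make it singular, and Fubini's theorem shows that for almost
  all \<open>\<alpha>0\<close> it is invertible at almost all \<open>x\<close>, for all \<open>k\<close> at once. This is the only point that
  excludes values of \<open>\<alpha>0\<close>. Countably many balls cover the strict saddle points, and a convergent trajectory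
  is trapped in one of them from some time on, so the null sets of the local argument can be pulled back
  to time 0 (\<open>avoids_if_locally_trapped_negligible\<close>).

  The three schedules enter only through positivity, a divergent sum and the dichotomy of the rates.\<close>

section \<open>Spectral theorem for self-adjoint operators\<close>

definition selfadjoint :: "('a::real_inner \<Rightarrow> 'a) \<Rightarrow> bool" where
  "selfadjoint A \<longleftrightarrow> linear A \<and> (\<forall>x y. A x \<bullet> y = x \<bullet> A y)"

text \<open>The finite-dimensional spectral theorem. On an invariant subspace the quadratic form
  \<open>A x \<bullet> x\<close> attains its maximum over the unit sphere, and a maximizer is an eigenvector; by
  symmetry its orthogonal complement is again invariant and has smaller dimension.\<close>

lemma selfadjoint_orthonormal_eigenbasis_on:
  fixes A :: "'a::euclidean_space \<Rightarrow> 'a"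
  assumes lin: "linear A" and sym: "\<And>x y. A x \<bullet> y = x \<bullet> A y"
    and S: "subspace S" "A ` S \<subseteq> S"
  shows "\<exists>B. B \<subseteq> S \<and> finite B \<and> pairwise orthogonal B \<and> (\<forall>b\<in>B. norm b = 1 \<and> (\<exists>c. A b = c *\<^sub>R b)) \<and> span B = S"
  using S
proof (induction "dim S" arbitrary: S rule: less_induct)
  case less
  interpret A: linear A by fact
  show ?case
  proof (cases "S = {0}")
    case True
    then show ?thesis by (intro exI[of _ "{}"]) (auto simp: pairwise_def)
  next
    case False
    have "0 \<in> S" using less.prems by (simp add: subspace_0)
    with False obtain s where s: "s \<in> S" "s \<noteq> 0" by blast
    let ?K = "sphere 0 1 \<inter> S"
    have "s /\<^sub>R norm s \<in> ?K"
      using s less.prems by (auto intro: subspace_scale)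
    then have "?K \<noteq> {}" by blast
    moreover have "compact ?K"
      by (intro compact_Int_closed compact_sphere closed_subspace less.prems)
    moreover have "continuous_on ?K (\<lambda>x. A x \<bullet> x)"
      using lin by (intro continuous_intros linear_continuous_on) (simp add: linear_linear)
    ultimately obtain v where v: "v \<in> ?K" and vmax: "\<And>y. y \<in> ?K \<Longrightarrow> A y \<bullet> y \<le> A v \<bullet> v"
      using continuous_attains_sup[of ?K "\<lambda>x. A x \<bullet> x"] by blast
    define c where "c = A v \<bullet> v"
    have nv: "norm v = 1" "v \<in> S" "v \<bullet> v = 1"
      using v by (auto simp: norm_eq_1)
    \<comment> \<open>Homogeneity turns maximality on the sphere into an inequality on all of \<open>S\<close>.\<close>
    have rayleigh: "A y \<bullet> y \<le> c * (y \<bullet> y)" if "y \<in> S" for y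
    proof (cases "y = 0")
      case False
      have "A (y /\<^sub>R norm y) \<bullet> (y /\<^sub>R norm y) \<le> c"
        unfolding c_def using that less.prems False
        by (intro vmax) (auto intro: subspace_scale)
      then have "(A y \<bullet> y) / (norm y)\<^sup>2 \<le> c"
        by (simp add: A.scale power2_eq_square field_simps)
      then show ?thesis
        using False by (simp add: divide_simps power2_norm_eq_inner)
    qed (simp add: A.zero)
    \<comment> \<open>At a maximum the first variation in a direction orthogonal to \<open>v\<close> vanishes.\<close>
    have crit: "A v \<bullet> w = 0" if w: "w \<in> S" "v \<bullet> w = 0" for w
    proof -
      define m where "m = c * (w \<bullet> w) - A w \<bullet> w"
      have ineq: "2 * t * (A v \<bullet> w) \<le> t\<^sup>2 * m" for t
      proof -
        have "v + t *\<^sub>R w \<in> S"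
          using nv w less.prems by (auto intro: subspace_add subspace_scale)
        have swap: "A w \<bullet> v = A v \<bullet> w" "w \<bullet> v = 0"
          using sym[of w v] w by (simp_all add: inner_commute)
        have "A (v + t *\<^sub>R w) \<bullet> (v + t *\<^sub>R w) = c + 2 * t * (A v \<bullet> w) + t\<^sup>2 * (A w \<bullet> w)"
          by (simp add: A.add A.scale inner_add_left inner_add_right swap c_def power2_eq_square algebra_simps)
        moreover have "(v + t *\<^sub>R w) \<bullet> (v + t *\<^sub>R w) = 1 + t\<^sup>2 * (w \<bullet> w)"
          using nv w swap by (simp add: inner_add_left inner_add_right power2_eq_square)
        ultimately have "c + 2 * t * (A v \<bullet> w) + t\<^sup>2 * (A w \<bullet> w) \<le> c * (1 + t\<^sup>2 * (w \<bullet> w))"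
          using rayleigh[OF \<open>v + t *\<^sub>R w \<in> S\<close>] by simp
        then show ?thesis by (simp add: m_def algebra_simps)
      qed
      show ?thesis
      proof (rule ccontr)
        assume nz: "A v \<bullet> w \<noteq> 0"
        define q where "q = A v \<bullet> w"
        \<comment> \<open>A step so short that the linear term \<open>2 t q\<close> outweighs the quadratic term \<open>t\<^sup>2 m\<close>.\<close>
        define t where "t = q / (\<bar>m\<bar> + 1)"
        have "2 * t * q \<le> t\<^sup>2 * m" using ineq q_def by blast
        moreover have "t\<^sup>2 * m \<le> t\<^sup>2 * (\<bar>m\<bar> + 1)" by (intro mult_left_mono) auto
        moreover have "t\<^sup>2 * (\<bar>m\<bar> + 1) = t * q"
          by (simp add: t_def power2_eq_square)
        moreover have "q * q > 0"
          using nz unfolding q_def by (metis not_real_square_gt_zero)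
        then have "q * q / (\<bar>m\<bar> + 1) > 0"
          by (rule divide_pos_pos) simp
        then have "t * q > 0"
          by (simp add: t_def del: zero_less_divide_iff)
        ultimately show False by linarith
      qed
    qed
    define w where "w = A v - c *\<^sub>R v"
    have "w \<in> S" unfolding w_def using less.prems nv by (auto intro!: subspace_diff subspace_scale)
    moreover have "v \<bullet> w = 0"
      using nv by (simp add: w_def inner_diff_right c_def inner_commute)
    ultimately have "w \<bullet> w = 0"
      using crit[of w] by (simp add: w_def inner_diff_left)
    then have eig: "A v = c *\<^sub>R v" by (simp add: w_def)
    define S' where "S' = {x \<in> S. v \<bullet> x = 0}"
    have sub: "subspace S'"
      using less.prems by (auto simp: S'_def subspace_def inner_add_right)
    have "v \<bullet> A x = c * (v \<bullet> x)" for x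
      using sym[of v x] eig by simp
    then have inv: "A ` S' \<subseteq> S'"
      using less.prems by (auto simp: S'_def)
    have "S' \<subseteq> S" "v \<notin> S'" using nv by (auto simp: S'_def)
    then have "S' \<subset> S" using nv(2) by blast
    then have "dim S' < dim S"
      using sub less.prems by (intro dim_psubset) (simp add: span_eq_iff[THEN iffD2])
    from less.hyps[OF this sub inv] obtain B where B: "B \<subseteq> S'" "finite B" "pairwise orthogonal B"
      "\<forall>b\<in>B. norm b = 1 \<and> (\<exists>c. A b = c *\<^sub>R b)" "span B = S'" by blast
    have "span (insert v B) = S"
    proof
      show "span (insert v B) \<subseteq> S"
        using B nv less.prems by (intro span_minimal) (auto simp: S'_def)
      show "S \<subseteq> span (insert v B)"
      proof
        fix x assume x: "x \<in> S"
        have "x - (v \<bullet> x) *\<^sub>R v \<in> S'"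
          using x nv less.prems
          by (auto simp: S'_def inner_diff_right intro!: subspace_diff subspace_scale)
        then show "x \<in> span (insert v B)"
          using B by (auto simp: span_insert)
      qed
    qed
    moreover have "pairwise orthogonal (insert v B)"
      using B by (auto simp: pairwise_insert orthogonal_def S'_def inner_commute)
    ultimately show ?thesis
      using B nv eig by (intro exI[of _ "insert v B"]) (auto simp: S'_def)
  qed
qed

locale orthonormal_eigenbasis =
  fixes A :: "'a::euclidean_space \<Rightarrow> 'a" and B :: "'a set" and l :: "'a \<Rightarrow> real"
  assumes selfadjoint: "selfadjoint A"
    and finite_basis: "finite B"
    and orthogonal_basis: "pairwise orthogonal B"
    and norm_basis: "b \<in> B \<Longrightarrow> norm b = 1"
    and span_basis: "span B = UNIV"
    and eigen: "b \<in> B \<Longrightarrow> A b = l b *\<^sub>R b"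
begin

definition proj :: "'a set \<Rightarrow> 'a \<Rightarrow> 'a" where
  "proj J z = (\<Sum>b\<in>J. (z \<bullet> b) *\<^sub>R b)"

lemma inner_A_basis: "b \<in> B \<Longrightarrow> A z \<bullet> b = l b * (z \<bullet> b)"
  using selfadjoint eigen by (simp add: selfadjoint_def)

lemma proj_add: "proj J (y + z) = proj J y + proj J z"
  by (simp add: proj_def inner_add_left scaleR_add_left sum.distrib)

lemma proj_scaleR: "proj J (a *\<^sub>R z) = a *\<^sub>R proj J z"
  by (simp add: proj_def scaleR_sum_right)

lemma proj_diff: "proj J (y - z) = proj J y - proj J z"
  by (simp add: proj_def inner_diff_left scaleR_diff_left sum_subtractf)

lemma norm_proj:
  assumes "J \<subseteq> B"
  shows "(norm (proj J z))\<^sup>2 = (\<Sum>b\<in>J. (z \<bullet> b)\<^sup>2)"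
proof -
  have "(norm (proj J z))\<^sup>2 = (\<Sum>b\<in>J. (norm ((z \<bullet> b) *\<^sub>R b))\<^sup>2)"
    unfolding proj_def
  proof (rule norm_sum_Pythagorean)
    show "finite J" using assms finite_basis by (rule finite_subset)
    show "pairwise (\<lambda>i j. orthogonal ((z \<bullet> i) *\<^sub>R i) ((z \<bullet> j) *\<^sub>R j)) J"
      using orthogonal_basis assms by (auto simp: pairwise_def orthogonal_def subset_iff)
  qed
  also have "\<dots> = (\<Sum>b\<in>J. (z \<bullet> b)\<^sup>2)"
    using assms norm_basis by (intro sum.cong) (auto simp: power_mult_distrib subset_iff)
  finally show ?thesis .
qed

lemma inner_proj_basis:
  assumes "J \<subseteq> B" "b \<in> B"
  shows "proj J z \<bullet> b = (if b \<in> J then z \<bullet> b else 0)"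
proof -
  have fin: "finite J" using assms finite_basis finite_subset by blast
  have "proj J z \<bullet> b = (\<Sum>i\<in>J. if i = b then z \<bullet> b else 0)"
    unfolding proj_def inner_sum_left
  proof (rule sum.cong[OF refl])
    fix i assume "i \<in> J"
    then show "(z \<bullet> i) *\<^sub>R i \<bullet> b = (if i = b then z \<bullet> b else 0)"
      using assms orthogonal_basis norm_basis[of b]
      by (auto simp: pairwise_def orthogonal_def norm_eq_1)
  qed
  then show ?thesis using fin by simp
qed

lemma eq_zero_if_orthogonal_basis:
  assumes "\<And>b. b \<in> B \<Longrightarrow> z \<bullet> b = 0"
  shows "z = 0"
proof -
  have "orthogonal z z"
    using assms span_basis by (intro orthogonal_to_span[of z B]) (auto simp: orthogonal_def)
  then show ?thesis by (simp add: orthogonal_def)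
qed

lemma proj_split:
  assumes "J \<subseteq> B"
  shows "proj J z + proj (B - J) z = z"
proof -
  have "proj J z + proj (B - J) z - z = 0"
    using assms by (intro eq_zero_if_orthogonal_basis)
      (auto simp: inner_add_left inner_diff_left inner_proj_basis)
  then show ?thesis by simp
qed

lemma norm_proj_le:
  assumes "J \<subseteq> B"
  shows "norm (proj J z) \<le> norm z"
proof -
  have "(norm (proj J z))\<^sup>2 \<le> (norm (proj B z))\<^sup>2"
    using assms finite_basis by (simp add: norm_proj sum_mono2)
  moreover have "proj B z = z"
    using proj_split[of B z] by (simp add: proj_def)
  ultimately show ?thesis by (simp add: power2_le_iff_abs_le)
qed

end

lemma selfadjoint_orthonormal_eigenbasis:
  assumes "selfadjoint A"
  obtains B l where "orthonormal_eigenbasis A B l"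
proof -
  have A: "linear A" "\<And>x y. A x \<bullet> y = x \<bullet> A y"
    using assms by (auto simp: selfadjoint_def)
  obtain B where B: "finite B" "pairwise orthogonal B"
      "\<forall>b\<in>B. norm b = 1 \<and> (\<exists>c. A b = c *\<^sub>R b)" "span B = UNIV"
    using selfadjoint_orthonormal_eigenbasis_on[OF A, of UNIV] by auto
  then obtain l where "\<forall>b\<in>B. A b = l b *\<^sub>R b" by metis
  with B assms show thesis by (intro that[of B l] orthonormal_eigenbasis.intro) auto
qed

section \<open>Linearization of the gradient and symmetry of the Hessian\<close>

text \<open>The map minus its linear part at \<open>x\<close> has a uniformly small derivative near \<open>x\<close>, hence a small
  Lipschitz constant. The cone argument needs this strict form of differentiability, which compares
  \<^emph>\<open>any\<close> two nearby points, because neither of two trajectories sits at the saddle.\<close>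

lemma C1_linearization_error:
  fixes G :: "real ^ 'n \<Rightarrow> real ^ 'n" and H :: "real ^ 'n \<Rightarrow> real ^ 'n ^ 'n"
  assumes deriv: "\<And>x. (G has_derivative (*v) (H x)) (at x)"
    and cont: "continuous_on UNIV H" and "e > 0"
  obtains d where "d > 0"
    "\<And>y z. y \<in> ball x d \<Longrightarrow> z \<in> ball x d \<Longrightarrow> norm (G y - G z - H x *v (y - z)) \<le> e * norm (y - z)"
proof -
  define s where "s y = (\<Sum>i\<in>UNIV. \<Sum>j\<in>UNIV. \<bar>(H y - H x) $ i $ j\<bar>)" for y
  have "continuous_on UNIV s"
    unfolding s_def using cont by (auto intro!: continuous_intros)
  then have "isCont s x" by (simp add: continuous_on_eq_continuous_at)
  moreover have "s x = 0" by (simp add: s_def)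
  ultimately obtain d where d: "d > 0" "\<And>y. dist y x < d \<Longrightarrow> s y < e"
    using \<open>e > 0\<close> unfolding continuous_at_eps_delta
    by (metis abs_ge_self diff_zero dist_real_def order_le_less_trans)
  show thesis
  proof (rule that[OF d(1)])
    fix y z assume yz: "y \<in> ball x d" "z \<in> ball x d"
    have "norm ((\<lambda>y. G y - H x *v y) y - (\<lambda>y. G y - H x *v y) z) \<le> e * norm (y - z)"
    proof (rule differentiable_bound[of "ball x d" _ "\<lambda>u. (*v) (H u - H x)"])
      fix u assume u: "u \<in> ball x d"
      have "((\<lambda>y. G y - H x *v y) has_derivative (\<lambda>h. H u *v h - H x *v h)) (at u within ball x d)"
        by (intro has_derivative_diff has_derivative_at_withinI[OF deriv]
            bounded_linear_imp_has_derivative) (simp add: linear_linear[symmetric])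
      then show "((\<lambda>y. G y - H x *v y) has_derivative (*v) (H u - H x)) (at u within ball x d)"
        by (rule has_derivative_eq_rhs) (simp add: fun_eq_iff matrix_vector_mult_diff_rdistrib)
      have "onorm ((*v) (H u - H x)) \<le> s u"
        unfolding s_def by (rule onorm_le_matrix_component_sum)
      also have "s u < e" using u d by (simp add: dist_commute)
      finally show "onorm ((*v) (H u - H x)) \<le> e" by simp
    qed (use yz in auto)
    then show "norm (G y - G z - H x *v (y - z)) \<le> e * norm (y - z)"
      by (simp add: matrix_vector_mult_diff_distrib algebra_simps)
  qed
qed

lemma C2_gradient_has_derivative:
  fixes f :: "real ^ 'n \<Rightarrow> real"
  assumes "C2 f"
  shows "(gradient f has_derivative (*v) (hessian f x)) (at x)"
  using assms unfolding C2_def hessian_def by (simp add: jacobian_works)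

lemma C2_has_derivative:
  fixes f :: "real ^ 'n \<Rightarrow> real"
  assumes "C2 f"
  shows "(f has_derivative (\<lambda>h. h \<bullet> gradient f x)) (at x)"
  using assms GDERIV_gradient[of f x] unfolding C2_def gderiv_def by blast

text \<open>Symmetry of second derivatives. The second difference
  \<open>f (x + t h + t k) - f (x + t h) - f (x + t k) + f x\<close> is symmetric in \<open>h\<close> and \<open>k\<close>, and the mean
  value theorem together with strict differentiability of the gradient shows that it equals
  \<open>t\<^sup>2 (H k \<bullet> h)\<close> up to an error \<open>e t\<^sup>2\<close> with \<open>e\<close> as small as desired.\<close>

lemma hessian_selfadjoint:
  fixes f :: "real ^ 'n \<Rightarrow> real"
  assumes "C2 f"
  shows "selfadjoint ((*v) (hessian f x))"
proof -
  let ?G = "gradient f" and ?H = "(*v) (hessian f x)"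
  have bound: "\<bar>?H k \<bullet> h - ?H h \<bullet> k\<bar> \<le> e * (2 * norm h * norm k)" if "e > 0" for h k e
  proof -
    obtain d where d: "d > 0" and lin: "\<And>y z. y \<in> ball x d \<Longrightarrow> z \<in> ball x d \<Longrightarrow>
        norm (?G y - ?G z - ?H (y - z)) \<le> e * norm (y - z)"
      using C1_linearization_error[OF C2_gradient_has_derivative[OF assms] _ \<open>e > 0\<close>] assms
      unfolding C2_def by blast
    \<comment> \<open>Small enough for the whole parallelogram spanned by \<open>t h\<close> and \<open>t k\<close> to lie in the ball.\<close>
    define t where "t = d / (norm h + norm k + 1)"
    have t: "t > 0" "t * (norm h + norm k) < d"
      using d by (simp_all add: t_def divide_simps add_nonneg_pos mult_less_cancel_left_pos)
    define D where "D h k = f (x + t *\<^sub>R h + t *\<^sub>R k) - f (x + t *\<^sub>R h) - f (x + t *\<^sub>R k) + f x" for h k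
    have diff: "\<bar>D h k - t\<^sup>2 * (?H k \<bullet> h)\<bar> \<le> t\<^sup>2 * (e * norm h * norm k)"
      if small: "t * (norm h + norm k) < d" for h k
    proof -
      define F where "F s = f (x + t *\<^sub>R k + s *\<^sub>R h) - f (x + s *\<^sub>R h)" for s
      have along: "((\<lambda>s. f (p + s *\<^sub>R h)) has_field_derivative ?G (p + s *\<^sub>R h) \<bullet> h) (at s)" for p s
      proof -
        have "((\<lambda>s. p + s *\<^sub>R h) has_derivative (\<lambda>u. u *\<^sub>R h)) (at s)"
          by (auto intro!: derivative_eq_intros)
        from has_derivative_compose[OF this C2_has_derivative[OF assms]]
        show ?thesis
          unfolding has_field_derivative_def
          by (rule has_derivative_eq_rhs) (simp add: fun_eq_iff inner_commute mult.commute)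
      qed
      have DF: "(F has_field_derivative (?G (x + t *\<^sub>R k + s *\<^sub>R h) - ?G (x + s *\<^sub>R h)) \<bullet> h) (at s)" for s
        unfolding F_def inner_diff_left by (intro DERIV_diff along)
      obtain s where s: "0 < s" "s < t"
        "F t - F 0 = (t - 0) * ((?G (x + t *\<^sub>R k + s *\<^sub>R h) - ?G (x + s *\<^sub>R h)) \<bullet> h)"
        using MVT2[OF t(1) DF] by blast
      define E where "E = ?G (x + t *\<^sub>R k + s *\<^sub>R h) - ?G (x + s *\<^sub>R h) - ?H (t *\<^sub>R k)"
      have sh: "s * norm h \<le> t * norm h" using s by (intro mult_right_mono) auto
      have tk: "t * norm k \<ge> 0" using t by simp
      have "t * norm h + t * norm k < d" using small by (simp add: distrib_left)
      then have "s * norm h < d" "t * norm k + s * norm h < d" using sh tk by linarith+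
      then have "norm (t *\<^sub>R k + s *\<^sub>R h) < d" "norm (s *\<^sub>R h) < d"
        using norm_triangle_ineq[of "t *\<^sub>R k" "s *\<^sub>R h"] s t(1) by auto
      then have "x + t *\<^sub>R k + s *\<^sub>R h \<in> ball x d" "x + s *\<^sub>R h \<in> ball x d"
        by (simp_all add: dist_norm norm_minus_commute algebra_simps)
      from lin[OF this] have E: "norm E \<le> e * (t * norm k)"
        using t by (simp add: E_def)
      have "D h k = F t - F 0" by (simp add: D_def F_def algebra_simps)
      also have "\<dots> = t\<^sup>2 * (?H k \<bullet> h) + t * (E \<bullet> h)"
        using s(3) by (simp add: E_def matrix_vector_mult_scaleR inner_diff_left power2_eq_square algebra_simps)
      finally have "\<bar>D h k - t\<^sup>2 * (?H k \<bullet> h)\<bar> = t * \<bar>E \<bullet> h\<bar>"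
        using t by (simp add: abs_mult)
      also have "\<dots> \<le> t * (e * (t * norm k) * norm h)"
        using t E by (intro mult_left_mono order_trans[OF Cauchy_Schwarz_ineq2] mult_right_mono) auto
      finally show ?thesis by (simp add: power2_eq_square mult_ac)
    qed
    have "D k h = D h k" by (simp add: D_def algebra_simps)
    moreover have "\<bar>D h k - t\<^sup>2 * (?H k \<bullet> h)\<bar> \<le> t\<^sup>2 * (e * norm h * norm k)"
      using t by (intro diff)
    moreover have "\<bar>D k h - t\<^sup>2 * (?H h \<bullet> k)\<bar> \<le> t\<^sup>2 * (e * norm k * norm h)"
      using t by (intro diff) (simp add: add.commute)
    moreover have "t\<^sup>2 * (e * norm k * norm h) = t\<^sup>2 * (e * norm h * norm k)"
      by (simp add: mult_ac)
    ultimately have "\<bar>t\<^sup>2 * (?H k \<bullet> h) - t\<^sup>2 * (?H h \<bullet> k)\<bar> \<le> 2 * (t\<^sup>2 * (e * norm h * norm k))"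
      by linarith
    also have "\<bar>t\<^sup>2 * (?H k \<bullet> h) - t\<^sup>2 * (?H h \<bullet> k)\<bar> = t\<^sup>2 * \<bar>?H k \<bullet> h - ?H h \<bullet> k\<bar>"
      by (simp add: abs_mult flip: right_diff_distrib)
    also have "2 * (t\<^sup>2 * (e * norm h * norm k)) = t\<^sup>2 * (e * (2 * norm h * norm k))"
      by simp
    finally have "t\<^sup>2 * \<bar>?H k \<bullet> h - ?H h \<bullet> k\<bar> \<le> t\<^sup>2 * (e * (2 * norm h * norm k))" .
    then show ?thesis using t by simp
  qed
  have "?H k \<bullet> h - ?H h \<bullet> k = 0" for h k
  proof (rule ccontr)
    define m where "m = \<bar>?H k \<bullet> h - ?H h \<bullet> k\<bar>"
    define M where "M = 2 * norm h * norm k"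
    assume "?H k \<bullet> h - ?H h \<bullet> k \<noteq> 0"
    then have m: "m > 0" by (simp add: m_def)
    have M: "M \<ge> 0" by (simp add: M_def)
    have "m / (M + 1) > 0" using m M by simp
    from bound[OF this, of k h] have "m \<le> m / (M + 1) * M"
      unfolding m_def M_def .
    with m M show False by (simp add: divide_simps)
  qed
  then show ?thesis
    unfolding selfadjoint_def by (auto simp: inner_commute matrix_vector_mul_linear)
qed

section \<open>Invariant cones and trapped trajectories\<close>

context orthonormal_eigenbasis
begin

text \<open>A gradient step multiplies the coordinate along an eigenvector \<open>b\<close> by \<open>1 - a * l b\<close>, so
  rates that hold for every coordinate in \<open>J\<close> pass to the whole component.\<close>

lemma proj_expands:
  assumes "J \<subseteq> B" "0 \<le> r" "\<And>b. b \<in> J \<Longrightarrow> r \<le> \<bar>1 - a * l b\<bar>"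
  shows "r * norm (proj J z) \<le> norm (proj J (z - a *\<^sub>R A z))"
proof -
  have "(r * norm (proj J z))\<^sup>2 = (\<Sum>b\<in>J. r\<^sup>2 * (z \<bullet> b)\<^sup>2)"
    using assms by (simp add: power_mult_distrib norm_proj sum_distrib_left)
  also have "\<dots> \<le> (\<Sum>b\<in>J. ((z - a *\<^sub>R A z) \<bullet> b)\<^sup>2)"
  proof (rule sum_mono)
    fix b assume b: "b \<in> J"
    have "r\<^sup>2 \<le> (1 - a * l b)\<^sup>2"
      using assms(2) assms(3)[OF b] by (simp add: abs_le_square_iff[symmetric])
    moreover have "(z - a *\<^sub>R A z) \<bullet> b = (1 - a * l b) * (z \<bullet> b)"
      using b assms(1) by (auto simp: inner_diff_left inner_A_basis algebra_simps)
    ultimately show "r\<^sup>2 * (z \<bullet> b)\<^sup>2 \<le> ((z - a *\<^sub>R A z) \<bullet> b)\<^sup>2"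
      by (simp add: power_mult_distrib mult_right_mono)
  qed
  also have "\<dots> = (norm (proj J (z - a *\<^sub>R A z)))\<^sup>2"
    using assms by (simp add: norm_proj)
  finally show ?thesis
    by (rule power2_le_imp_le) simp
qed

lemma proj_nonexpansive:
  assumes "J \<subseteq> B" "\<And>b. b \<in> J \<Longrightarrow> \<bar>1 - a * l b\<bar> \<le> 1"
  shows "norm (proj J (z - a *\<^sub>R A z)) \<le> norm (proj J z)"
proof -
  have "(norm (proj J (z - a *\<^sub>R A z)))\<^sup>2 = (\<Sum>b\<in>J. ((z - a *\<^sub>R A z) \<bullet> b)\<^sup>2)"
    using assms by (simp add: norm_proj)
  also have "\<dots> \<le> (\<Sum>b\<in>J. (z \<bullet> b)\<^sup>2)"
  proof (rule sum_mono)
    fix b assume b: "b \<in> J"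
    have "(1 - a * l b)\<^sup>2 \<le> 1"
      using assms(2)[OF b] by (simp add: abs_square_le_1)
    moreover have "(z - a *\<^sub>R A z) \<bullet> b = (1 - a * l b) * (z \<bullet> b)"
      using b assms(1) by (auto simp: inner_diff_left inner_A_basis algebra_simps)
    ultimately show "((z - a *\<^sub>R A z) \<bullet> b)\<^sup>2 \<le> (z \<bullet> b)\<^sup>2"
      by (simp add: power_mult_distrib mult_left_le_one_le)
  qed
  also have "\<dots> = (norm (proj J z))\<^sup>2"
    using assms by (simp add: norm_proj)
  finally show ?thesis
    by (rule power2_le_imp_le) simp
qed

text \<open>The invariant cone. While the unstable component dominates, the total length of \<open>w\<close> is at most
  twice the unstable one, so the nonlinear error is at most \<open>2 a e\<close> times it. The choice
  \<open>4 e \<le> m\<close> lets half of the expansion rate absorb this error: the unstable component still grows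
  by the factor \<open>1 + a m / 2\<close>, and the same amount of slack keeps the difference in the cone.\<close>

lemma cone_step:
  assumes J: "J \<subseteq> B" and a: "a > 0" and e: "4 * e \<le> m" "0 < e"
    and expand: "\<And>b. b \<in> J \<Longrightarrow> 1 + a * m \<le> \<bar>1 - a * l b\<bar>"
    and contract: "\<And>b. b \<in> B - J \<Longrightarrow> \<bar>1 - a * l b\<bar> \<le> 1"
    and error: "norm R \<le> e * norm w"
    and cone: "norm (proj (B - J) w) \<le> norm (proj J w)"
  defines "w' \<equiv> w - a *\<^sub>R (A w + R)"
  shows "norm (proj (B - J) w') \<le> norm (proj J w')"
    and "(1 + a * (m / 2)) * norm (proj J w) \<le> norm (proj J w')"
proof -
  let ?p = "norm (proj J w)"
  have "norm w \<le> ?p + norm (proj (B - J) w)"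
    using norm_triangle_ineq[of "proj J w" "proj (B - J) w"] proj_split[OF J] by simp
  then have "norm w \<le> 2 * ?p" using cone by linarith
  then have "norm R \<le> e * (2 * ?p)"
    using error e by (meson mult_left_mono order_trans less_imp_le)
  then have R: "a * norm R \<le> 2 * a * e * ?p"
    using a by (simp add: mult_ac)
  have "4 * e * (a * ?p) \<le> m * (a * ?p)"
    using e a by (intro mult_right_mono) auto
  then have em: "2 * a * e * ?p \<le> a * (m / 2) * ?p" by (simp add: mult_ac)
  have split: "proj K w' = proj K (w - a *\<^sub>R A w) - a *\<^sub>R proj K R" for K
    by (simp add: w'_def proj_diff proj_add proj_scaleR algebra_simps)
  have err: "norm (a *\<^sub>R proj K R) \<le> a * norm R" if "K \<subseteq> B" for K
    using norm_proj_le[OF that, of R] a by simp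
  have "(1 + a * m) * ?p \<le> norm (proj J (w - a *\<^sub>R A w))"
    using J a e expand by (intro proj_expands) auto
  moreover have "norm (proj J (w - a *\<^sub>R A w)) - norm (a *\<^sub>R proj J R) \<le> norm (proj J w')"
    unfolding split by (rule norm_triangle_ineq2)
  ultimately show growth: "(1 + a * (m / 2)) * ?p \<le> norm (proj J w')"
    using err[OF J] R em by (simp add: algebra_simps)
  have "norm (proj (B - J) w') \<le> norm (proj (B - J) (w - a *\<^sub>R A w)) + norm (a *\<^sub>R proj (B - J) R)"
    unfolding split by (rule norm_triangle_ineq4)
  moreover have "norm (proj (B - J) (w - a *\<^sub>R A w)) \<le> norm (proj (B - J) w)"
    using contract by (intro proj_nonexpansive) auto
  ultimately show "norm (proj (B - J) w') \<le> norm (proj J w')"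
    using growth err[of "B - J"] R em cone by (simp add: algebra_simps)
qed

text \<open>Such a set is the graph of a Lipschitz map from the complementary to the unstable directions, hence the
  Lipschitz image of a subset of a hyperplane.\<close>

lemma negligible_if_differences_avoid_cone:
  assumes J: "J \<subseteq> B" "J \<noteq> {}"
    and cone: "\<And>y z. y \<in> W \<Longrightarrow> z \<in> W \<Longrightarrow> norm (proj J (y - z)) \<le> norm (proj (B - J) (y - z))"
  shows "negligible W"
proof -
  let ?q = "proj (B - J)"
  have lip: "norm (y - z) \<le> 2 * norm (?q y - ?q z)" if "y \<in> W" "z \<in> W" for y z
    using cone[OF that] norm_triangle_ineq[of "proj J (y - z)" "?q (y - z)"]
    by (simp add: proj_split[OF J(1)]) (simp add: proj_diff)
  then have "inj_on ?q W" by (fastforce simp: inj_on_def)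
  then obtain g where g: "\<And>y. y \<in> W \<Longrightarrow> g (?q y) = y"
    by (metis inv_into_f_f)
  obtain b where b: "b \<in> J" using J by blast
  with J have "?q ` W \<subseteq> {x. b \<bullet> x = 0}"
    by (auto simp: inner_commute[of b] inner_proj_basis)
  moreover have "b \<noteq> 0" using b J norm_basis by fastforce
  ultimately have "negligible (?q ` W)"
    using negligible_hyperplane negligible_subset by blast
  then have "negligible (g ` ?q ` W)"
  proof (rule negligible_locally_Lipschitz_image[OF order_refl])
    fix x assume "x \<in> ?q ` W"
    then show "\<exists>T C. open T \<and> x \<in> T \<and> (\<forall>y\<in>?q ` W \<inter> T. norm (g y - g x) \<le> C * norm (y - x))"
      using g lip by (intro exI[of _ UNIV] exI[of _ 2]) auto
  qed
  moreover have "W \<subseteq> g ` ?q ` W" using g by force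
  ultimately show ?thesis by (rule negligible_subset)
qed

text \<open>Two trapped points whose difference lies in the cone would separate without bound:
  the unstable component of the difference of their trajectories grows by at least
  \<open>1 + m / 2 * \<alpha> k\<close> at each step, and the product of these factors diverges with the sum of the step
  sizes. The trapped points therefore form a Lipschitz graph.\<close>

lemma negligible_trapped_points:
  fixes G :: "'a \<Rightarrow> 'a" and \<alpha> :: "nat \<Rightarrow> real"
  assumes J: "J \<subseteq> B" "J \<noteq> {}" and \<alpha>: "\<And>k. \<alpha> k > 0" "\<not> summable \<alpha>"
    and e: "4 * e \<le> m" "0 < e"
    and expand: "\<And>k b. b \<in> J \<Longrightarrow> 1 + \<alpha> k * m \<le> \<bar>1 - \<alpha> k * l b\<bar>"
    and contract: "\<And>k b. b \<in> B - J \<Longrightarrow> \<bar>1 - \<alpha> k * l b\<bar> \<le> 1"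
    and "bounded U"
    and error: "\<And>y z. y \<in> U \<Longrightarrow> z \<in> U \<Longrightarrow> norm (G y - G z - A (y - z)) \<le> e * norm (y - z)"
  shows "negligible {y. \<forall>k. trajectory (\<lambda>k x. x - \<alpha> k *\<^sub>R G x) y k \<in> U}" (is "negligible ?W")
proof (rule negligible_if_differences_avoid_cone[OF J], rule ccontr)
  let ?t = "trajectory (\<lambda>k x. x - \<alpha> k *\<^sub>R G x)"
  fix y z assume yz: "y \<in> ?W" "z \<in> ?W"
    and "\<not> norm (proj J (y - z)) \<le> norm (proj (B - J) (y - z))"
  then have start: "norm (proj (B - J) (y - z)) < norm (proj J (y - z))" by simp
  define w where "w k = ?t y k - ?t z k" for k
  define p where "p k = norm (proj J (w k))" for k
  have step: "norm (proj (B - J) (w (Suc k))) \<le> p (Suc k) \<and> (1 + \<alpha> k * (m / 2)) * p k \<le> p (Suc k)"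
    if "norm (proj (B - J) (w k)) \<le> p k" for k
  proof -
    let ?R = "G (?t y k) - G (?t z k) - A (w k)"
    have "w (Suc k) = w k - \<alpha> k *\<^sub>R (A (w k) + ?R)"
      by (simp add: w_def algebra_simps)
    moreover have "norm ?R \<le> e * norm (w k)"
      using yz unfolding w_def by (intro error) auto
    ultimately show ?thesis
      using cone_step[of J "\<alpha> k" e m ?R "w k"] J(1) \<alpha>(1) e expand contract that unfolding p_def by auto
  qed
  have cone: "norm (proj (B - J) (w k)) \<le> p k" for k
    using start step by (induction k) (auto simp: w_def p_def)
  have growth: "p 0 * (1 + m / 2 * sum \<alpha> {..<k}) \<le> p k" for k
  proof (induction k)
    case (Suc k)
    have nn: "0 \<le> \<alpha> k * (m / 2)" "0 \<le> p 0" using \<alpha>(1)[of k] e by (auto simp: p_def)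
    have "0 \<le> sum \<alpha> {..<k}" using \<alpha>(1) by (intro sum_nonneg) (simp add: less_imp_le)
    then have "p 0 * 1 \<le> p 0 * (1 + m / 2 * sum \<alpha> {..<k})"
      using nn e by (intro mult_left_mono) auto
    then have "p 0 \<le> p k" using Suc by simp
    then have "\<alpha> k * (m / 2) * p 0 \<le> \<alpha> k * (m / 2) * p k"
      using nn by (intro mult_left_mono) auto
    then show ?case
      using Suc step[OF cone, of k] by (simp add: algebra_simps)
  qed simp
  obtain C where C: "\<And>x. x \<in> U \<Longrightarrow> norm x \<le> C"
    using \<open>bounded U\<close> unfolding bounded_iff by blast
  have pC: "p k \<le> 2 * C" for k
  proof -
    have "p k \<le> norm (w k)" unfolding p_def by (rule norm_proj_le[OF J(1)])
    also have "\<dots> \<le> norm (?t y k) + norm (?t z k)"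
      unfolding w_def by (rule norm_triangle_ineq4)
    also have "\<dots> \<le> 2 * C" using C[of "?t y k"] C[of "?t z k"] yz by auto
    finally show ?thesis .
  qed
  have "p 0 > 0" using start norm_ge_zero by (auto simp: p_def w_def intro: le_less_trans)
  then have "sum \<alpha> {..<k} \<le> (2 * C / p 0 - 1) * 2 / m" for k
    using order_trans[OF growth pC, of k] e by (simp add: field_simps)
  then have "summable \<alpha>"
    using \<alpha>(1) by (intro summableI_nonneg_bounded[where x = "(2 * C / p 0 - 1) * 2 / m"]) (auto simp: less_imp_le)
  with \<alpha>(2) show False by blast
qed

end

section \<open>Null sets pulled back along gradient steps\<close>

text \<open>Fubini's theorem, applied to the closed set of pairs \<open>(x, a)\<close> with a singular matrix:
  its slices at fixed \<open>x\<close> are finite, so almost all of its slices at fixed \<open>a\<close> are null.\<close>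

lemma AE_invertible_id_minus_scaled:
  fixes H :: "real ^ 'n \<Rightarrow> real ^ 'n ^ 'n"
  assumes cont: "continuous_on UNIV H"
    and fin: "\<And>x. finite {a::real. det (mat 1 - (a * c) *\<^sub>R H x) = 0}"
  shows "AE a in lebesgue. negligible {x. det (mat 1 - (a * c) *\<^sub>R H x) = 0}"
proof -
  let ?P = "\<lambda>x a. det (mat 1 - (a * c) *\<^sub>R H x) \<noteq> 0"
  have "continuous_on UNIV (\<lambda>p::(real ^ 'n) \<times> real. det (mat 1 - (snd p * c) *\<^sub>R H (fst p)))"
    unfolding det_def
    by (intro continuous_intros continuous_on_compose2[OF cont]) auto
  then have "open ((\<lambda>p::(real ^ 'n) \<times> real. det (mat 1 - (snd p * c) *\<^sub>R H (fst p))) -` (- {0}))"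
    by (intro open_vimage) auto
  then have "{p. ?P (fst p) (snd p)} \<in> sets (lborel \<Otimes>\<^sub>M (lborel :: real measure))"
    unfolding lborel_prod by (simp add: vimage_def)
  moreover have "AE a in lborel. ?P x a" for x
    using finite_imp_null_set_lborel[OF fin[of x]] by (rule AE_I') auto
  ultimately have "AE a in lborel. AE x in lborel. ?P x a"
    by (subst lborel_pair.AE_commute[symmetric]) (auto simp: space_pair_measure)
  then have "AE a in lborel. negligible {x. \<not> ?P x a}"
  proof (rule AE_mp, intro AE_I2 impI)
    fix a assume "AE x in lborel. ?P x a"
    then have "AE x in lebesgue. ?P x a" by (rule AE_completion)
    then show "negligible {x. \<not> ?P x a}"
      unfolding eventually_ae_filter
      by (auto simp: negligible_iff_null_sets[symmetric] intro: negligible_subset)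
  qed
  then show ?thesis by (simp add: AE_completion)
qed

text \<open>Only reciprocals of eigenvalues can make the operator singular.\<close>

lemma (in orthonormal_eigenbasis) finite_singular_scalings:
  "finite {a. \<exists>v. v \<noteq> 0 \<and> v - (a * c) *\<^sub>R A v = 0}"
proof (rule finite_subset)
  show "{a. \<exists>v. v \<noteq> 0 \<and> v - (a * c) *\<^sub>R A v = 0} \<subseteq> (\<lambda>b. 1 / (c * l b)) ` B"
  proof clarify
    fix a v assume v: "v \<noteq> 0" "v - (a * c) *\<^sub>R A v = 0"
    obtain b where b: "b \<in> B" "v \<bullet> b \<noteq> 0"
      using v(1) eq_zero_if_orthogonal_basis by blast
    have "v \<bullet> b = (a * c) * (A v \<bullet> b)"
      using v(2) by (metis eq_iff_diff_eq_0 inner_scaleR_left)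
    then have ac: "a * (c * l b) = 1"
      using b by (simp add: inner_A_basis)
    then have "c * l b \<noteq> 0" by auto
    with ac have "a = 1 / (c * l b)" by (simp add: eq_divide_eq)
    with b show "a \<in> (\<lambda>b. 1 / (c * l b)) ` B" by blast
  qed
qed (use finite_basis in simp)

lemma det_id_minus_scaled_eq_0_iff:
  fixes H :: "real ^ 'n ^ 'n"
  shows "det (mat 1 - a *\<^sub>R H) = 0 \<longleftrightarrow> (\<exists>v. v \<noteq> 0 \<and> v - a *\<^sub>R (H *v v) = 0)"
proof -
  have "(mat 1 - a *\<^sub>R H) *v v = v - a *\<^sub>R (H *v v)" for v
    by (simp add: matrix_vector_mult_diff_rdistrib scaleR_matrix_vector_assoc)
  moreover have "det (mat 1 - a *\<^sub>R H) = 0 \<longleftrightarrow> \<not> (\<forall>v. (mat 1 - a *\<^sub>R H) *v v = 0 \<longrightarrow> v = 0)"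
    using invertible_det_nz[of "mat 1 - a *\<^sub>R H"]
    by (simp add: invertible_left_inverse matrix_left_invertible_ker)
  ultimately show ?thesis by auto
qed

lemma AE_gradient_step_nonsingular:
  assumes "C2 f"
  shows "AE a in lebesgue. negligible {x. det (mat 1 - (a * c) *\<^sub>R hessian f x) = 0}"
proof (rule AE_invertible_id_minus_scaled)
  show "continuous_on UNIV (hessian f)" using assms by (simp add: C2_def)
  fix x
  obtain B l where "orthonormal_eigenbasis ((*v) (hessian f x)) B l"
    using selfadjoint_orthonormal_eigenbasis[OF hessian_selfadjoint[OF assms]] .
  then show "finite {a. det (mat 1 - (a * c) *\<^sub>R hessian f x) = 0}"
    unfolding det_id_minus_scaled_eq_0_iff by (rule orthonormal_eigenbasis.finite_singular_scalings)
qed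

text \<open>Away from its critical points the gradient step is locally invertible with a locally Lipschitz
  inverse, so there it pulls null sets back to null sets; the critical points are null by assumption.\<close>

lemma negligible_vimage_gradient_step:
  assumes "C2 f" and N: "negligible N"
    and nonsing: "negligible {x. det (mat 1 - \<alpha> k *\<^sub>R hessian f x) = 0}"
  shows "negligible (gradient_descent f \<alpha> k -` N)"
proof -
  let ?g = "gradient_descent f \<alpha> k" and ?Z = "{x. det (mat 1 - \<alpha> k *\<^sub>R hessian f x) = 0}"
  have "negligible {x \<in> - ?Z. ?g x \<in> N}"
  proof (rule negligible_differentiable_vimage[OF N, of _ "\<lambda>x v. v - \<alpha> k *\<^sub>R (hessian f x *v v)"])
    fix x assume x: "x \<in> - ?Z"
    have lin: "linear (\<lambda>v. v - \<alpha> k *\<^sub>R (hessian f x *v v))"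
      by (intro linear_compose_sub linear_ident linear_compose_scale_right matrix_vector_mul_linear)
    show "inj (\<lambda>v. v - \<alpha> k *\<^sub>R (hessian f x *v v))"
      unfolding linear_injective_0[OF lin] using x det_id_minus_scaled_eq_0_iff by auto
    have "((\<lambda>y. y - \<alpha> k *\<^sub>R gradient f y) has_derivative (\<lambda>v. v - \<alpha> k *\<^sub>R (hessian f x *v v))) (at x within - ?Z)"
      by (intro has_derivative_diff has_derivative_ident has_derivative_scaleR_right
          has_derivative_at_withinI[OF C2_gradient_has_derivative[OF assms(1)]])
    then show "(?g has_derivative (\<lambda>v. v - \<alpha> k *\<^sub>R (hessian f x *v v))) (at x within - ?Z)"
      by (simp add: gradient_descent_def[abs_def])
  qed
  then have "negligible ({x \<in> - ?Z. ?g x \<in> N} \<union> ?Z)"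
    using nonsing by (rule negligible_Un)
  then show ?thesis by (rule negligible_subset) auto
qed

lemma negligible_trajectory_vimage:
  fixes g :: "nat \<Rightarrow> 'a \<Rightarrow> 'a::euclidean_space"
  assumes "\<And>k N. negligible N \<Longrightarrow> negligible (g k -` N)" "negligible N"
  shows "negligible {x. trajectory g x n \<in> N}"
  using assms(2)
proof (induction n arbitrary: N)
  case (Suc n)
  then show ?case using Suc.IH[of "g n -` N"] assms(1) by simp
qed simp

section \<open>Avoidance of strict saddle points\<close>

lemma trajectory_add:
  "trajectory g x (n + k) = trajectory (\<lambda>j. g (n + j)) (trajectory g x n) k"
  by (induction k) auto

text \<open>A trajectory that converges to \<open>s\<close> is trapped in a neighbourhood of \<open>s\<close> from some time on,
  and this time may be taken as late as desired. By the Lindelof property countably many of the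
  neighbourhoods \<open>U\<close> suffice, and each of the resulting null sets of trapped points is pulled back to the
  initial time along finitely many steps.\<close>

lemma avoids_if_locally_trapped_negligible:
  fixes g :: "nat \<Rightarrow> 'a \<Rightarrow> 'a::euclidean_space"
  assumes pullback: "\<And>k N. negligible N \<Longrightarrow> negligible (g k -` N)"
    and trap: "\<And>s. s \<in> S \<Longrightarrow> \<exists>U. open U \<and> s \<in> U \<and>
       (\<forall>\<^sub>F n in sequentially. negligible {y. \<forall>k. trajectory (\<lambda>j. g (n + j)) y k \<in> U})"
  shows "avoids g S"
proof -
  let ?W = "\<lambda>U n. {y. \<forall>k. trajectory (\<lambda>j. g (n + j)) y k \<in> U}"
  define F where "F = {U. open U \<and> (\<forall>\<^sub>F n in sequentially. negligible (?W U n))}"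
  obtain F' where F': "F' \<subseteq> F" "countable F'" "\<Union>F' = \<Union>F"
    using Lindelof[of F] by (auto simp: F_def)
  have ev: "eventually (\<lambda>n. negligible (?W U n)) sequentially" "open U" if "U \<in> F'" for U
    using that F' by (auto simp: F_def)
  \<comment> \<open>Times \<open>n\<close> too early for the trapped set to be known null contribute nothing.\<close>
  define E where "E U n = (if negligible (?W U n) then {x. trajectory g x n \<in> ?W U n} else {})" for U n
  have neg: "negligible (E U n)" for U n
    using negligible_trajectory_vimage[of g "?W U n" n] pullback by (simp add: E_def)
  have "negligible (\<Union>U\<in>F'. \<Union>n. E U n)"
    using F'(2) neg by (intro negligible_countable_Union countable_image) (auto intro!: negligible_countable_Union)
  moreover have "{x0. \<exists>x\<in>S. trajectory g x0 \<longlonglongrightarrow> x} \<subseteq> (\<Union>U\<in>F'. \<Union>n. E U n)"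
  proof safe
    fix x0 s assume s: "s \<in> S" "trajectory g x0 \<longlonglongrightarrow> s"
    obtain U where U: "U \<in> F'" "s \<in> U"
      using trap[OF s(1)] F'(3) unfolding F_def by blast
    have "\<forall>\<^sub>F n in sequentially. trajectory g x0 n \<in> U"
      using s(2) U ev(2) by (blast dest: topological_tendstoD)
    then obtain M where M: "\<And>n. n \<ge> M \<Longrightarrow> trajectory g x0 n \<in> U"
      unfolding eventually_sequentially by blast
    obtain n where n: "n \<ge> M" "negligible (?W U n)"
      using ev(1)[OF U(1)] unfolding eventually_sequentially by (metis nle_le)
    have "trajectory g x0 n \<in> ?W U n"
      using M n by (auto simp flip: trajectory_add)
    with n U show "x0 \<in> (\<Union>U\<in>F'. \<Union>n. E U n)" by (auto simp: E_def)
  qed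
  ultimately show ?thesis
    unfolding avoids_def negligible_iff_null_sets[symmetric] by (rule negligible_subset)
qed

text \<open>Here \<open>c\<close> stands for an eigenvalue of the Hessian: its eigendirection is eventually either expanding, at
  a rate proportional to the step size, or nonexpanding. This is the common ground of constant steps, where large positive
  eigenvalues may overshoot and expand as well, and vanishing steps, where exactly the
  negative eigenvalues expand.\<close>

definition rate_dichotomy :: "(nat \<Rightarrow> real) \<Rightarrow> bool" where
  "rate_dichotomy \<alpha> \<longleftrightarrow> (\<forall>c.
     (\<exists>m>0. \<forall>\<^sub>F k in sequentially. 1 + \<alpha> k * m \<le> \<bar>1 - \<alpha> k * c\<bar>) \<or>
     (\<forall>\<^sub>F k in sequentially. \<bar>1 - \<alpha> k * c\<bar> \<le> 1))"

lemma rate_dichotomy_const: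
  assumes "a > 0"
  shows "rate_dichotomy (\<lambda>_. a)"
  unfolding rate_dichotomy_def
proof
  fix c
  show "(\<exists>m>0. \<forall>\<^sub>F k in sequentially. 1 + a * m \<le> \<bar>1 - a * c\<bar>) \<or>
     (\<forall>\<^sub>F k in sequentially. \<bar>1 - a * c\<bar> \<le> 1)"
  proof (cases "\<bar>1 - a * c\<bar> \<le> 1")
    case False
    then show ?thesis
      using assms by (intro disjI1 exI[of _ "(\<bar>1 - a * c\<bar> - 1) / a"]) auto
  qed simp
qed

lemma rate_dichotomy_tendsto_0:
  assumes pos: "\<And>k. \<alpha> k > 0" and lim: "\<alpha> \<longlonglongrightarrow> 0"
  shows "rate_dichotomy \<alpha>"
  unfolding rate_dichotomy_def
proof
  fix c
  show "(\<exists>m>0. \<forall>\<^sub>F k in sequentially. 1 + \<alpha> k * m \<le> \<bar>1 - \<alpha> k * c\<bar>) \<or>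
     (\<forall>\<^sub>F k in sequentially. \<bar>1 - \<alpha> k * c\<bar> \<le> 1)"
  proof (cases "c < 0")
    case True
    then show ?thesis
      by (intro disjI1 exI[of _ "- c"]) (auto intro: always_eventually)
  next
    case False
    have "(\<lambda>k. \<alpha> k * c) \<longlonglongrightarrow> 0" using tendsto_mult_right[OF lim, of c] by simp
    then have "\<forall>\<^sub>F k in sequentially. \<alpha> k * c < 2" by (rule order_tendstoD) simp
    then have "\<forall>\<^sub>F k in sequentially. \<bar>1 - \<alpha> k * c\<bar> \<le> 1"
    proof eventually_elim
      case (elim k)
      moreover have "\<alpha> k * c \<ge> 0" using False pos[of k] by simp
      ultimately show ?case by linarith
    qed
    then show ?thesis ..
  qed
qed

text \<open>The unstable directions \<open>J\<close> are all the eigenvectors that eventually expand; the negative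
  eigenvalue of a strict saddle provides at least one of them. Taking all of them, and not only the
  negative eigenvalues, leaves a complement on which all late steps are nonexpanding.\<close>

lemma negligible_trapped_near_strict_saddle:
  assumes "C2 f" and s: "s \<in> strict_saddle_points f"
    and \<alpha>: "\<And>k. \<alpha> k > 0" "\<not> summable \<alpha>" "rate_dichotomy \<alpha>"
  shows "\<exists>U. open U \<and> s \<in> U \<and>
    (\<forall>\<^sub>F n in sequentially. negligible {y. \<forall>k. trajectory (\<lambda>j. gradient_descent f \<alpha> (n + j)) y k \<in> U})"
proof -
  let ?A = "(*v) (hessian f s)"
  obtain B l where eb: "orthonormal_eigenbasis ?A B l"
    using selfadjoint_orthonormal_eigenbasis[OF hessian_selfadjoint[OF \<open>C2 f\<close>]] .
  interpret orthonormal_eigenbasis ?A B l by (fact eb)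
  define J where "J = {b \<in> B. \<exists>m>0. \<forall>\<^sub>F k in sequentially. 1 + \<alpha> k * m \<le> \<bar>1 - \<alpha> k * l b\<bar>}"
  have J: "J \<subseteq> B" "finite J" using finite_basis by (auto simp: J_def)
  have "\<forall>b\<in>J. \<exists>m. m > 0 \<and> (\<forall>\<^sub>F k in sequentially. 1 + \<alpha> k * m \<le> \<bar>1 - \<alpha> k * l b\<bar>)"
    by (simp add: J_def)
  from bchoice[OF this] obtain \<mu> where \<mu>: "\<And>b. b \<in> J \<Longrightarrow> \<mu> b > 0"
      "\<And>b. b \<in> J \<Longrightarrow> \<forall>\<^sub>F k in sequentially. 1 + \<alpha> k * \<mu> b \<le> \<bar>1 - \<alpha> k * l b\<bar>"
    by blast
  have "J \<noteq> {}"
  proof -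
    obtain c v where c: "c < 0" "v \<noteq> 0" "?A v = c *\<^sub>R v"
      using s by (auto simp: strict_saddle_points_def is_eigenvalue_def)
    obtain b where b: "b \<in> B" "v \<bullet> b \<noteq> 0"
      using c(2) eq_zero_if_orthogonal_basis by blast
    then have "l b = c"
      using inner_A_basis[of b v] c(3) by simp
    then have "b \<in> J"
      using b c(1) unfolding J_def by (auto intro!: exI[of _ "- c"] always_eventually)
    then show ?thesis by blast
  qed
  \<comment> \<open>Finitely many expanding eigenvectors share one rate and, below, one starting time.\<close>
  define m where "m = Min (\<mu> ` J)"
  have m: "m > 0" unfolding m_def using J \<open>J \<noteq> {}\<close> \<mu>(1) by (subst Min_gr_iff) auto
  have "\<forall>\<^sub>F k in sequentially. \<forall>b\<in>J. 1 + \<alpha> k * m \<le> \<bar>1 - \<alpha> k * l b\<bar>"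
  proof (rule eventually_ball_finite[OF J(2)], rule ballI)
    fix b assume b: "b \<in> J"
    have "\<alpha> k * m \<le> \<alpha> k * \<mu> b" for k
      using b J \<alpha>(1)[of k] unfolding m_def by (intro mult_left_mono) (auto intro: Min_le)
    then show "\<forall>\<^sub>F k in sequentially. 1 + \<alpha> k * m \<le> \<bar>1 - \<alpha> k * l b\<bar>"
      using \<mu>(2)[OF b] by (elim eventually_mono) (meson add_left_mono order_trans)
  qed
  moreover have "\<forall>\<^sub>F k in sequentially. \<forall>b\<in>B - J. \<bar>1 - \<alpha> k * l b\<bar> \<le> 1"
    using finite_basis \<alpha>(3) by (intro eventually_ball_finite) (auto simp: J_def rate_dichotomy_def)
  ultimately have "\<forall>\<^sub>F k in sequentially. (\<forall>b\<in>J. 1 + \<alpha> k * m \<le> \<bar>1 - \<alpha> k * l b\<bar>) \<and>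
      (\<forall>b\<in>B - J. \<bar>1 - \<alpha> k * l b\<bar> \<le> 1)"
    by (rule eventually_conj)
  then obtain N where N: "\<And>k b. k \<ge> N \<Longrightarrow> b \<in> J \<Longrightarrow> 1 + \<alpha> k * m \<le> \<bar>1 - \<alpha> k * l b\<bar>"
      "\<And>k b. k \<ge> N \<Longrightarrow> b \<in> B - J \<Longrightarrow> \<bar>1 - \<alpha> k * l b\<bar> \<le> 1"
    unfolding eventually_sequentially by blast
  have "m / 4 > 0" using m by simp
  obtain d where d: "d > 0" "\<And>y z. y \<in> ball s d \<Longrightarrow> z \<in> ball s d \<Longrightarrow>
      norm (gradient f y - gradient f z - ?A (y - z)) \<le> m / 4 * norm (y - z)"
    using C1_linearization_error[OF C2_gradient_has_derivative[OF \<open>C2 f\<close>] _ \<open>m / 4 > 0\<close>] \<open>C2 f\<close>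
    unfolding C2_def by blast
  have "negligible {y. \<forall>k. trajectory (\<lambda>j. gradient_descent f \<alpha> (n + j)) y k \<in> ball s d}" if "n \<ge> N" for n
  proof -
    have "\<not> summable (\<lambda>j. \<alpha> (n + j))"
      using \<alpha>(2) summable_iff_shift[of \<alpha> n] by (simp add: add.commute)
    then have "negligible {y. \<forall>k. trajectory (\<lambda>j x. x - \<alpha> (n + j) *\<^sub>R gradient f x) y k \<in> ball s d}"
      using \<alpha>(1) m N that d(2) J(1) \<open>J \<noteq> {}\<close>
      by (intro negligible_trapped_points[where J = J and m = m and e = "m / 4"]) auto
    then show ?thesis by (simp add: gradient_descent_def[abs_def])
  qed
  then show ?thesis
    using d(1) unfolding eventually_sequentially by (intro exI[of _ "ball s d"]) auto
qed

text \<open>The exceptional step sizes are a countable union, over the iterations \<open>k\<close>, of the null sets of those \<open>a\<close>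
  for which the \<open>k\<close>-th step has a critical set of positive measure.\<close>

lemma AE_gradient_descent_avoids_strict_saddles:
  assumes "C2 f" and c: "\<And>k. c k > 0" "\<not> summable c" "\<And>a. a > 0 \<Longrightarrow> rate_dichotomy (\<lambda>k. a * c k)"
  shows "AE a in lebesgue. a > 0 \<longrightarrow>
    avoids (gradient_descent f (\<lambda>k. a * c k)) (strict_saddle_points f)"
proof -
  have "AE a in lebesgue. \<forall>k. negligible {x. det (mat 1 - (a * c k) *\<^sub>R hessian f x) = 0}"
    unfolding AE_all_countable using AE_gradient_step_nonsingular[OF \<open>C2 f\<close>] by blast
  then show ?thesis
  proof (rule AE_mp, intro AE_I2 impI)
    fix a :: real
    assume ns: "\<forall>k. negligible {x. det (mat 1 - (a * c k) *\<^sub>R hessian f x) = 0}" and a: "a > 0"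
    show "avoids (gradient_descent f (\<lambda>k. a * c k)) (strict_saddle_points f)"
    proof (rule avoids_if_locally_trapped_negligible)
      show "negligible (gradient_descent f (\<lambda>k. a * c k) k -` N)" if "negligible N" for k N
        using ns by (intro negligible_vimage_gradient_step[OF \<open>C2 f\<close> that]) blast
    next
      fix s assume "s \<in> strict_saddle_points f"
      then show "\<exists>U. open U \<and> s \<in> U \<and> (\<forall>\<^sub>F n in sequentially.
          negligible {y. \<forall>k. trajectory (\<lambda>j. gradient_descent f (\<lambda>k. a * c k) (n + j)) y k \<in> U})"
        using a c by (intro negligible_trapped_near_strict_saddle[OF \<open>C2 f\<close>])
          (auto simp: summable_cmult_iff)
    qed
  qed
qed

section \<open>Step-size schedules\<close>

lemma polynomial_rate_not_summable:
  assumes "\<gamma> \<le> 1"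
  shows "\<not> summable (\<lambda>k. 1 / (real k + 1) powr \<gamma>)"
proof -
  have "(\<lambda>k. 1 / (real k + 1) powr \<gamma>) = (\<lambda>k. real (Suc k) powr - \<gamma>)"
    by (simp add: powr_minus_divide add.commute)
  then show ?thesis
    using assms summable_Suc_iff[of "\<lambda>k. real k powr - \<gamma>"] by (simp add: summable_real_powr_iff)
qed

lemma polynomial_rate_tendsto_0:
  assumes "\<gamma> > 0"
  shows "(\<lambda>k. 1 / (real k + 1) powr \<gamma>) \<longlonglongrightarrow> 0"
proof -
  have "(\<lambda>k. (real k + 1) powr - \<gamma>) \<longlonglongrightarrow> 0"
    using assms by (intro tendsto_neg_powr) (auto intro: filterlim_at_top_add_at_top filterlim_tendsto_add_at_top filterlim_real_sequentially simp: add.commute)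
  then show ?thesis by (simp add: powr_minus_divide)
qed

text \<open>The cosine never equals \<open>- 1\<close>, since \<open>2 k + 1\<close> is odd while twice an odd multiple of
  \<open>2 T + 1\<close> is even; and it is periodic in \<open>k\<close>, so it takes only finitely many values.\<close>

lemma cosine_factor_bounded_below:
  obtains \<delta> where "\<delta> > 0" "\<And>k::nat. \<delta> \<le> 1 + cos (pi * (real k + 1/2) / (2 * real T + 1))"
proof -
  define F where "F k = 1 + cos (pi * (real k + 1/2) / (2 * real T + 1))" for k :: nat
  \<comment> \<open>Raising \<open>k\<close> by \<open>q\<close> raises the argument of the cosine by \<open>2 pi\<close>.\<close>
  define q where "q = 2 * (2 * T + 1)"
  have pos: "F k > 0" for k
  proof -
    have "cos (pi * (real k + 1/2) / (2 * real T + 1)) \<noteq> -1"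
    proof
      assume "cos (pi * (real k + 1/2) / (2 * real T + 1)) = -1"
      then obtain n :: int where "pi * (real k + 1/2) / (2 * real T + 1) = (2 * real_of_int n + 1) * pi"
        unfolding cos_eq_minus1 by blast
      then have "pi * (real k + 1/2) = pi * ((2 * real_of_int n + 1) * (2 * real T + 1))"
        by (simp add: divide_eq_eq mult_ac)
      then have "real k + 1/2 = (2 * real_of_int n + 1) * (2 * real T + 1)"
        by (subst (asm) mult_cancel_left) simp
      then have "real_of_int (2 * int k + 1) = real_of_int (2 * ((2 * n + 1) * (2 * int T + 1)))"
        by simp
      then have "2 * int k + 1 = 2 * ((2 * n + 1) * (2 * int T + 1))"
        by (simp only: of_int_eq_iff)
      then show False by presburger
    qed
    then show ?thesis
      using cos_ge_minus_one[of "pi * (real k + 1/2) / (2 * real T + 1)"] unfolding F_def by linarith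
  qed
  have period: "F (k + q) = F k" for k
  proof -
    have "pi * (real (k + q) + 1/2) / (2 * real T + 1) = pi * (real k + 1/2) / (2 * real T + 1) + 2 * pi"
      by (simp add: q_def divide_simps) (simp add: algebra_simps)
    then show ?thesis by (simp add: F_def)
  qed
  have "F k = F (k mod q)" for k
  proof -
    have "F (i + j * q) = F i" for i j
      by (induction j) (use period in \<open>simp_all add: add.assoc[symmetric] add.commute[of q]\<close>)
    from this[of "k mod q" "k div q"] show ?thesis by simp
  qed
  moreover have "k mod q < q" for k by (simp add: q_def)
  ultimately have "Min (F ` {..<q}) \<le> F k" for k
    by (metis Min_le finite_imageI finite_lessThan imageI lessThan_iff)
  moreover have "Min (F ` {..<q}) > 0"
    using pos by (subst Min_gr_iff) (auto simp: q_def)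
  ultimately show thesis using that unfolding F_def by blast
qed

lemma cosine_rate_pos: "cosine_step \<gamma> T 1 k > 0"
proof -
  obtain \<delta> where "\<delta> > 0" "\<And>k::nat. \<delta> \<le> 1 + cos (pi * (real k + 1/2) / (2 * real T + 1))"
    using cosine_factor_bounded_below[of T] by blast
  then have "1 + cos (pi * (real k + 1/2) / (2 * real T + 1)) > 0"
    by (meson less_le_trans)
  then show ?thesis by (simp add: cosine_step_def)
qed

lemma cosine_rate_not_summable:
  assumes "\<gamma> \<le> 1"
  shows "\<not> summable (cosine_step \<gamma> T 1)"
proof
  assume sum: "summable (cosine_step \<gamma> T 1)"
  obtain \<delta> where \<delta>: "\<delta> > 0" "\<And>k::nat. \<delta> \<le> 1 + cos (pi * (real k + 1/2) / (2 * real T + 1))"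
    using cosine_factor_bounded_below[of T] by blast
  have "norm (\<delta> * (1 / (real k + 1) powr \<gamma>)) \<le> cosine_step \<gamma> T 1 k" if "k \<ge> 1" for k
    using mult_left_mono[OF \<delta>(2)[of k], of "1 / (real k + 1) powr \<gamma>"] \<delta>(1) that
    by (simp add: cosine_step_def mult.commute)
  with sum have "summable (\<lambda>k. \<delta> * (1 / (real k + 1) powr \<gamma>))"
    by (rule summable_comparison_test'[where N = 1])
  with polynomial_rate_not_summable[OF assms] \<delta>(1) show False
    by (simp only: summable_cmult_iff) simp
qed

lemma cosine_rate_tendsto_0:
  assumes "\<gamma> > 0"
  shows "cosine_step \<gamma> T 1 \<longlonglongrightarrow> 0"
proof (rule Lim_null_comparison)
  show "\<forall>\<^sub>F k in sequentially. norm (cosine_step \<gamma> T 1 k) \<le> 2 * (1 / (real k + 1) powr \<gamma>)"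
  proof (intro always_eventually allI)
    fix k
    have "1 / (real k + 1) powr \<gamma> * (1 + cos (pi * (real k + 1/2) / (2 * real T + 1)))
        \<le> 1 / (real k + 1) powr \<gamma> * 2"
      by (intro mult_left_mono) auto
    then show "norm (cosine_step \<gamma> T 1 k) \<le> 2 * (1 / (real k + 1) powr \<gamma>)"
      using cosine_rate_pos[of \<gamma> T k] by (auto simp: cosine_step_def)
  qed
  show "(\<lambda>k. 2 * (1 / (real k + 1) powr \<gamma>)) \<longlonglongrightarrow> 0"
    using tendsto_mult_right_zero[OF polynomial_rate_tendsto_0[OF assms], of 2] .
qed

theorem theorem5p1:
  fixes f :: "real ^ 'n \<Rightarrow> real"
  assumes "C2 f"
  shows "(AE \<alpha>0 in lebesgue. \<alpha>0 > 0 \<longrightarrow>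
            avoids (gradient_descent f (constant_step \<alpha>0)) (strict_saddle_points f)) \<and>
         (\<forall>\<gamma>::real. 0 < \<gamma> \<and> \<gamma> \<le> 1 \<longrightarrow>
            (AE \<alpha>0 in lebesgue. \<alpha>0 > 0 \<longrightarrow>
              avoids (gradient_descent f (polynomial_step \<gamma> \<alpha>0)) (strict_saddle_points f))) \<and>
         (\<forall>(\<gamma>::real) (T::nat). 0 < \<gamma> \<and> \<gamma> \<le> 1 \<longrightarrow>
            (AE \<alpha>0 in lebesgue. \<alpha>0 > 0 \<longrightarrow>
              avoids (gradient_descent f (cosine_step \<gamma> T \<alpha>0)) (strict_saddle_points f)))"
proof (intro conjI allI impI)
  show "AE \<alpha>0 in lebesgue. \<alpha>0 > 0 \<longrightarrow>
      avoids (gradient_descent f (constant_step \<alpha>0)) (strict_saddle_points f)"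
    using AE_gradient_descent_avoids_strict_saddles[OF assms, of "\<lambda>_. 1"] rate_dichotomy_const
    by (simp add: constant_step_def[abs_def] summable_const_iff)
next
  fix \<gamma> :: real
  assume \<gamma>: "0 < \<gamma> \<and> \<gamma> \<le> 1"
  have "polynomial_step \<gamma> \<alpha>0 = (\<lambda>k. \<alpha>0 * (1 / (real k + 1) powr \<gamma>))" for \<alpha>0
    by (simp add: polynomial_step_def[abs_def])
  moreover have "rate_dichotomy (\<lambda>k. a * (1 / (real k + 1) powr \<gamma>))" if "a > 0" for a
    using that \<gamma> tendsto_mult_right_zero[OF polynomial_rate_tendsto_0[of \<gamma>], of a]
    by (intro rate_dichotomy_tendsto_0) auto
  ultimately show "AE \<alpha>0 in lebesgue. \<alpha>0 > 0 \<longrightarrow>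
      avoids (gradient_descent f (polynomial_step \<gamma> \<alpha>0)) (strict_saddle_points f)"
    using AE_gradient_descent_avoids_strict_saddles[OF assms, of "\<lambda>k. 1 / (real k + 1) powr \<gamma>"]
      polynomial_rate_not_summable[of \<gamma>] \<gamma> by (simp del: divide_le_0_1_iff)
next
  fix \<gamma> :: real and T :: nat
  assume \<gamma>: "0 < \<gamma> \<and> \<gamma> \<le> 1"
  have steps: "(\<lambda>k. \<alpha>0 * cosine_step \<gamma> T 1 k) = cosine_step \<gamma> T \<alpha>0" for \<alpha>0
    by (auto simp: cosine_step_def)
  have "rate_dichotomy (\<lambda>k. a * cosine_step \<gamma> T 1 k)" if "a > 0" for a
    using that \<gamma> cosine_rate_pos tendsto_mult_right_zero[OF cosine_rate_tendsto_0[of \<gamma> T], of a]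
    by (intro rate_dichotomy_tendsto_0) auto
  with cosine_rate_not_summable[of \<gamma> T] \<gamma>
  have "AE \<alpha>0 in lebesgue. \<alpha>0 > 0 \<longrightarrow>
      avoids (gradient_descent f (\<lambda>k. \<alpha>0 * cosine_step \<gamma> T 1 k)) (strict_saddle_points f)"
    by (intro AE_gradient_descent_avoids_strict_saddles[OF assms cosine_rate_pos]) auto
  then show "AE \<alpha>0 in lebesgue. \<alpha>0 > 0 \<longrightarrow>
      avoids (gradient_descent f (cosine_step \<gamma> T \<alpha>0)) (strict_saddle_points f)"
    unfolding steps .
qed

end
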